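(* Let $m,n\ge 1$ be integers, let $W=[w_{j,i}]\in\mathbb{R}_+^{m\times n}$ be a matrix with nonnegative entries, and let $\mathbf{X}=(X_1,\dots,X_m)$ and $\mathbf{Y}=(Y_1,\dots,Y_n)$ be vectors with $X_j>0$ for all $j$ and $Y_i>0$ for all $i$. Consider the networked defense weakest-link game $\mathrm{NDWL}(W,\mathbf{X},\mathbf{Y})$, with strategy sets $\mathcal{F}_{\mathcal{X}}(\mathbf{X})$, $\mathcal{F}_{\mathcal{Y}}(\mathbf{Y})$ and defender payoff $\pi_{\mathcal{X}}(F_{\mathcal{X}},F_{\mathcal{Y}})$. For $S\in\mathcal{S}$ define $$\alpha(S):=\sum_{i=1}^n\frac{Y_i}{z_i(S)},\qquad z_i(S):=\sum_{j=1}^m w_{j,i}X_j s_{j,i},$$ and $$\alpha^\star:=\min_{S\in\mathcal{S}}\alpha(S),\qquad \mathrm{LB}:=\begin{cases}1-\dfrac{\alpha^\star}{2}, & \alpha^\star\le 1,\\[6pt] \dfrac{1}{2\alpha^\star}, & \alpha^\star\ge 1.\end{cases}$$ Then the defender's max-min value satisfies $$\sup_{F_{\mathcal{X}}\in\mathcal{F}_{\mathcal{X}}(\mathbf{X})}\ \inf_{F_{\mathcal{Y}}\in\mathcal{F}_{\mathcal{Y}}(\mathbf{Y})}\ \pi_{\mathcal{X}}(F_{\mathcal{X}},F_{\mathcal{Y}})\ \ge\ \mathrm{LB}.$$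
   Context: The game $\mathrm{NDWL}(W,\mathbf{X},\mathbf{Y})$ is played between a defender $\mathcal{X}$ with $m$ resource types (budgets $X_1,\dots,X_m>0$) and an attacker $\mathcal{Y}$ with $n$ attack types (budgets $Y_1,\dots,Y_n>0$). The entry $w_{j,i}\ge 0$ is the effectiveness of defender resource type $j$ against attack type $i$. A defender allocation is a matrix $\boldsymbol{x}=(x_{i,j})_{1\le i\le n,\,1\le j\le m}\in\mathbb{R}_+^{n\times m}$, where $x_{i,j}$ is the amount of resource type $j$ used against attack type $i$. An attacker allocation is a vector $y=(y_1,\dots,y_n)\in\mathbb{R}_+^n$. Here $\mathbb{R}_+=[0,\infty)$. Mixed strategies: $\mathcal{F}_{\mathcal{X}}(\mathbf{X})$ is the set of all probability distributions $F_{\mathcal{X}}$ on $\mathbb{R}_+^{n\times m}$ with $\mathbb{E}_{\boldsymbol{x}\sim F_{\mathcal{X}}}\big[\sum_{i=1}^n x_{i,j}\big]=X_j$ for every $j=1,\dots,m$. $\mathcal{F}_{\mathcal{Y}}(\mathbf{Y})$ is the set of all probability distributions $F_{\mathcal{Y}}$ on $\mathbb{R}_+^n$ with $\mathbb{E}_{y\sim F_{\mathcal{Y}}}[y_i]=Y_i$ for every $i=1,\dots,n$. The defender's expected payoff, with $\boldsymbol{x}\sim F_{\mathcal{X}}$ and $y\sim F_{\mathcal{Y}}$ drawn independently, is $$\pi_{\mathcal{X}}(F_{\mathcal{X}},F_{\mathcal{Y}})=\mathbb{E}_{\boldsymbol{x}\sim F_{\mathcal{X}},\,y\sim F_{\mathcal{Y}}}\Big[\mathbf{1}\Big\{\sum_{j=1}^m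 w_{j,i}x_{i,j}\ge y_i\ \ \forall i=1,\dots,n\Big\}\Big].$$ The set of routing matrices is $\mathcal{S}:=\{S=[s_{j,i}]\in\mathbb{R}_+^{m\times n}:\ \sum_{i=1}^n s_{j,i}=1\ \ \forall j=1,\dots,m\}$. Conventions: $Y_i/z_i(S)=+\infty$ when $z_i(S)=0$, so $\alpha(S)\in(0,+\infty]$; and $\frac{1}{2\alpha^\star}=0$ if $\alpha^\star=+\infty$. *)

theory Defs
  imports "HOL-Probability.Probability"
begin

text \<open>
  The index types \<open>'m\<close> (resource types) and \<open>'n\<close> (attack types) are finite and
  nonempty. A defender allocation \<open>x :: real ^ 'm ^ 'n\<close> has entries \<open>x $ i $ j\<close> with \<open>i\<close> the
  attack type, whereas \<open>W, S :: real ^ 'n ^ 'm\<close> are indexed as \<open>W $ j $ i\<close>.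
\<close>

definition defender_allocations :: "(real ^ 'm ^ 'n) set" where
  "defender_allocations = {x. \<forall>i j. 0 \<le> x $ i $ j}"

definition attacker_allocations :: "(real ^ 'n) set" where
  "attacker_allocations = {y. \<forall>i. 0 \<le> y $ i}"

text \<open>
  The moment conditions use \<^const>\<open>has_bochner_integral\<close>, so that integrability is
  part of the condition.
\<close>

definition defender_strategies :: "real ^ 'm \<Rightarrow> (real ^ 'm ^ 'n) measure set" where
  "defender_strategies X = {F. prob_space F
     \<and> sets F = sets (restrict_space borel defender_allocations)
     \<and> (\<forall>j. has_bochner_integral F (\<lambda>x. \<Sum>i\<in>UNIV. x $ i $ j) (X $ j))}"

definition attacker_strategies :: "real ^ 'n \<Rightarrow> (real ^ 'n) measure set" where
  "attacker_strategies Y = {F. prob_space F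
     \<and> sets F = sets (restrict_space borel attacker_allocations)
     \<and> (\<forall>i. has_bochner_integral F (\<lambda>y. y $ i) (Y $ i))}"

definition defender_payoff ::
    "real ^ 'n ^ 'm \<Rightarrow> (real ^ 'm ^ 'n) measure \<Rightarrow> (real ^ 'n) measure \<Rightarrow> real" where
  "defender_payoff W FX FY =
     (\<integral>(x, y). of_bool (\<forall>i. (\<Sum>j\<in>UNIV. W $ j $ i * x $ i $ j) \<ge> y $ i) \<partial>(FX \<Otimes>\<^sub>M FY))"

text \<open>
  Supremum and infimum are those of the reals; this is meaningful because the payoff lies
  between 0 and 1 and the strategy sets are nonempty (shown below).
\<close>

definition max_min_value :: "real ^ 'n ^ 'm \<Rightarrow> real ^ 'm \<Rightarrow> real ^ 'n \<Rightarrow> real" where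
  "max_min_value W X Y =
     (SUP FX \<in> defender_strategies X. INF FY \<in> attacker_strategies Y. defender_payoff W FX FY)"

definition routing_matrices :: "(real ^ 'n ^ 'm) set" where
  "routing_matrices = {S. (\<forall>j i. 0 \<le> S $ j $ i) \<and> (\<forall>j. (\<Sum>i\<in>UNIV. S $ j $ i) = 1)}"

definition routed :: "real ^ 'n ^ 'm \<Rightarrow> real ^ 'm \<Rightarrow> real ^ 'n ^ 'm \<Rightarrow> 'n \<Rightarrow> real" where
  "routed W X S i = (\<Sum>j\<in>UNIV. W $ j $ i * X $ j * S $ j $ i)"

text \<open>
  In \<^typ>\<open>ennreal\<close>, dividing a positive number by 0 gives \<open>\<infinity>\<close>,
  so a vanishing \<open>z\<^sub>i(S)\<close> makes the sum infinite.
\<close>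

definition alpha ::
    "real ^ 'n ^ 'm \<Rightarrow> real ^ 'm \<Rightarrow> real ^ 'n \<Rightarrow> real ^ 'n ^ 'm \<Rightarrow> ennreal" where
  "alpha W X Y S = (\<Sum>i\<in>UNIV. ennreal (Y $ i) / ennreal (routed W X S i))"

text \<open>The infimum is a minimum, see \<open>alpha_star_attained\<close>.\<close>

definition alpha_star :: "real ^ 'n ^ 'm \<Rightarrow> real ^ 'm \<Rightarrow> real ^ 'n \<Rightarrow> ennreal" where
  "alpha_star W X Y = (INF S \<in> routing_matrices. alpha W X Y S)"

text \<open>For \<open>a = \<infinity>\<close> the value is 0, since \<open>1 / \<infinity> = 0\<close> in \<^typ>\<open>ennreal\<close>.\<close>

definition lower_bound :: "ennreal \<Rightarrow> real" where
  "lower_bound a = (if a \<le> 1 then 1 - enn2real a / 2 else enn2real (1 / (2 * a)))"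

lemma lower_bound_infinity: "lower_bound \<infinity> = 0"
proof -
  have "\<not> (\<infinity> :: ennreal) \<le> 1"
    by (metis ennreal_one_neq_top infinity_ennreal_def top_unique)
  then show ?thesis
    by (simp add: lower_bound_def ennreal_mult_top)
qed

lemma alpha_eq_infinity:
  assumes "\<forall>i. Y $ i > 0" and "routed W X S i = 0"
  shows "alpha W X Y S = \<infinity>"
proof -
  have "ennreal (Y $ i) / ennreal (routed W X S i) = \<infinity>"
  proof -
    have "ennreal (Y $ i) \<noteq> 0"
      using assms(1) by (metis ennreal_eq_0_iff not_le)
    then show ?thesis
      using assms(2) by (simp add: ennreal_divide_eq_top_iff)
  qed
  then show ?thesis
    unfolding alpha_def by (auto simp: ennreal_sum_eq_top)
qed

lemma compact_routing_matrices: "compact (routing_matrices :: (real ^ 'n ^ 'm) set)"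
proof -
  have "closed (routing_matrices :: (real ^ 'n ^ 'm) set)"
    unfolding routing_matrices_def
    by (intro closed_Collect_conj closed_Collect_all closed_Collect_le closed_Collect_eq
        continuous_intros)
  moreover have "bounded (routing_matrices :: (real ^ 'n ^ 'm) set)"
  proof -
    have "norm S \<le> real CARD('m)" if "S \<in> routing_matrices" for S :: "real ^ 'n ^ 'm"
    proof -
      have "norm (S $ j) \<le> 1" for j
      proof -
        have "norm (S $ j) \<le> (\<Sum>i\<in>UNIV. \<bar>S $ j $ i\<bar>)"
          by (rule norm_le_l1_cart)
        also have "\<dots> = 1"
          using that by (simp add: routing_matrices_def)
        finally show ?thesis .
      qed
      then have "(\<Sum>j\<in>UNIV. norm (S $ j)) \<le> (\<Sum>j\<in>(UNIV::'m set). 1)"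
        by (intro sum_mono)
      moreover have "norm S \<le> (\<Sum>j\<in>UNIV. norm (S $ j))"
        unfolding norm_vec_def by (rule L2_set_le_sum) simp
      ultimately show ?thesis
        by simp
    qed
    then show ?thesis
      unfolding bounded_iff by blast
  qed
  ultimately show ?thesis
    by (simp add: compact_eq_bounded_closed)
qed

lemma routing_matrices_nonempty: "(routing_matrices :: (real ^ 'n ^ 'm) set) \<noteq> {}"
proof -
  have "(\<chi> j i. 1 / real CARD('n)) \<in> (routing_matrices :: (real ^ 'n ^ 'm) set)"
    by (simp add: routing_matrices_def)
  then show ?thesis
    by blast
qed

lemma alpha_star_attained:
  assumes "\<forall>i. Y $ i > 0"
  shows "\<exists>S \<in> routing_matrices. alpha W X Y S = alpha_star W X Y"
proof -
  have "continuous_on routing_matrices (\<lambda>S. alpha W X Y S)"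
    unfolding alpha_def divide_ennreal_def routed_def
    by (intro continuous_on_sum ennreal_continuous_on_cmult continuous_on_inverse_ennreal
        continuous_on_ennreal continuous_intros) auto
  then obtain S where "S \<in> routing_matrices"
    and "\<forall>T \<in> routing_matrices. alpha W X Y S \<le> alpha W X Y T"
    using continuous_attains_inf[OF compact_routing_matrices routing_matrices_nonempty] by blast
  then show ?thesis
    unfolding alpha_star_def by (intro bexI[of _ S] antisym INF_greatest INF_lower) auto
qed

lemma defender_strategies_nonempty:
  fixes X :: "real ^ 'm"
  assumes "\<forall>j. X $ j > 0"
  shows "(defender_strategies X :: (real ^ 'm ^ 'n) measure set) \<noteq> {}"
proof -
  let ?R = "restrict_space borel (defender_allocations :: (real ^ 'm ^ 'n) set)"
  define x :: "real ^ 'm ^ 'n" where "x = (\<chi> i j. X $ j / real CARD('n))"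
  have x: "x \<in> space ?R"
    using assms by (auto simp: space_restrict_space defender_allocations_def x_def less_imp_le)
  have "has_bochner_integral (return ?R x) (\<lambda>x. \<Sum>i\<in>UNIV. x $ i $ j) (X $ j)" for j
  proof -
    have m: "(\<lambda>x :: real ^ 'm ^ 'n. \<Sum>i\<in>UNIV. x $ i $ j) \<in> borel_measurable ?R"
      by (intro measurable_restrict_space1 borel_measurable_continuous_onI continuous_intros)
    interpret prob_space "return ?R x"
      by (rule prob_space_return[OF x])
    have ae: "AE u in return ?R x. (\<Sum>i\<in>UNIV. u $ i $ j) = X $ j"
      using x m by (subst AE_return) (auto simp: x_def)
    have c: "has_bochner_integral (return ?R x) (\<lambda>_. X $ j) (X $ j)"
      using prob_space by (simp add: has_bochner_integral_iff)
    show ?thesis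
    proof (rule iffD2[OF has_bochner_integral_cong_AE c])
      show "(\<lambda>x. \<Sum>i\<in>UNIV. x $ i $ j) \<in> borel_measurable (return ?R x)"
        by (subst measurable_cong_sets[OF sets_return refl]) (rule m)
    qed (use ae in simp_all)
  qed
  then have "return ?R x \<in> defender_strategies X"
    using prob_space_return[OF x] by (simp add: defender_strategies_def)
  then show ?thesis
    by blast
qed

lemma attacker_strategies_nonempty:
  fixes Y :: "real ^ 'n"
  assumes "\<forall>i. Y $ i > 0"
  shows "attacker_strategies Y \<noteq> {}"
proof -
  let ?R = "restrict_space borel (attacker_allocations :: (real ^ 'n) set)"
  have Y: "Y \<in> space ?R"
    using assms by (auto simp: space_restrict_space attacker_allocations_def less_imp_le)
  have "has_bochner_integral (return ?R Y) (\<lambda>y. y $ i) (Y $ i)" for i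
  proof -
    have m: "(\<lambda>y :: real ^ 'n. y $ i) \<in> borel_measurable ?R"
      by (intro measurable_restrict_space1 borel_measurable_continuous_onI continuous_intros)
    interpret prob_space "return ?R Y"
      by (rule prob_space_return[OF Y])
    have ae: "AE u in return ?R Y. u $ i = Y $ i"
      using Y m by (subst AE_return) auto
    have c: "has_bochner_integral (return ?R Y) (\<lambda>_. Y $ i) (Y $ i)"
      using prob_space by (simp add: has_bochner_integral_iff)
    show ?thesis
    proof (rule iffD2[OF has_bochner_integral_cong_AE c])
      show "(\<lambda>y. y $ i) \<in> borel_measurable (return ?R Y)"
        by (subst measurable_cong_sets[OF sets_return refl]) (rule m)
    qed (use ae in simp_all)
  qed
  then have "return ?R Y \<in> attacker_strategies Y"
    using prob_space_return[OF Y] by (simp add: attacker_strategies_def)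
  then show ?thesis
    by blast
qed

lemma defender_payoff_bounds:
  assumes "FX \<in> defender_strategies X" and "FY \<in> attacker_strategies Y"
  shows "0 \<le> defender_payoff W FX FY" and "defender_payoff W FX FY \<le> 1"
proof -
  interpret FX: prob_space FX
    using assms(1) by (simp add: defender_strategies_def)
  interpret FY: prob_space FY
    using assms(2) by (simp add: attacker_strategies_def)
  interpret P: pair_prob_space FX FY ..
  show "0 \<le> defender_payoff W FX FY"
    unfolding defender_payoff_def by (intro integral_nonneg_AE) auto
  have "defender_payoff W FX FY \<le> (\<integral>p. 1 \<partial>(FX \<Otimes>\<^sub>M FY))"
    unfolding defender_payoff_def by (intro integral_mono') auto
  then show "defender_payoff W FX FY \<le> 1"
    by (simp add: P.prob_space)
qed

end

theory Submission
  imports Defs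
begin

text \<open>
  The defender fixes an optimal routing matrix and scales the corresponding deterministic
  allocation by a random factor \<open>T\<close> of mean 1. He wins as soon as \<open>T \<ge> (\<Sum>i. y\<^sub>i / z\<^sub>i)\<close>, and the
  right-hand side has mean \<open>\<alpha>\<^sup>\<star>\<close> whatever the attacker does. This leaves a one-dimensional
  General Lotto game, in which \<open>T\<close> is taken uniform on \<open>[0, 2c]\<close> with probability \<open>1/c\<close> and 0
  otherwise, where \<open>c = max 1 \<alpha>\<^sup>\<star>\<close>.
\<close>

text \<open>The random factor, as a function of a uniform variable on \<open>[0, 1]\<close>.\<close>

definition lotto_scale :: "real \<Rightarrow> real \<Rightarrow> real" where
  "lotto_scale c u = 2 * c\<^sup>2 * u * indicator {0..1 / c} u"

abbreviation uniform_01 :: "real measure" where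
  "uniform_01 \<equiv> restrict_space lborel {0..1}"

lemma lotto_scale_nonneg: "0 \<le> lotto_scale c u"
  by (auto simp: lotto_scale_def indicator_def)

lemma borel_measurable_lotto_scale [measurable]: "lotto_scale c \<in> borel_measurable borel"
  unfolding lotto_scale_def by measurable

lemma prob_space_uniform_01: "prob_space uniform_01"
  by (rule prob_spaceI) (simp add: emeasure_restrict_space space_restrict_space)

lemma has_bochner_integral_lotto_scale:
  assumes "1 \<le> c"
  shows "has_bochner_integral uniform_01 (lotto_scale c) 1"
proof -
  \<comment> \<open>The antiderivative is \<open>c\<^sup>2 * u\<^sup>2\<close>, which rises from 0
    to 1 on \<open>{0..1 / c}\<close>.\<close>
  have "has_bochner_integral lborel (\<lambda>u. (2 * c\<^sup>2 * u) * indicator {0..1 / c} u)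
      (c\<^sup>2 * (1 / c)\<^sup>2 - c\<^sup>2 * 0\<^sup>2)"
    using assms
    by (intro has_bochner_integral_FTC_Icc_real)
      (auto intro!: derivative_eq_intros continuous_intros)
  moreover have "c\<^sup>2 * (1 / c)\<^sup>2 - c\<^sup>2 * 0\<^sup>2 = 1"
    using assms by (simp add: field_simps)
  \<comment> \<open>Since \<open>1 / c \<le> 1\<close>, the restriction to the unit interval cuts
    off nothing.\<close>
  moreover have "indicator {0..1} u *\<^sub>R lotto_scale c u = 2 * c\<^sup>2 * u * indicator {0..1 / c} u" for u
  proof -
    have "1 / c \<le> 1"
      using assms by simp
    then show ?thesis
      by (auto simp: lotto_scale_def indicator_def)
  qed
  ultimately show ?thesis
    by (simp add: has_bochner_integral_restrict_space)
qed

text \<open>The scale reaches \<open>s\<close> on \<open>{s / (2 * c\<^sup>2)..1 / c}\<close>, whose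
  length is the left-hand side. For \<open>s > 2 * c\<close> the left-hand side is negative. The
  tail bound is therefore affine in \<open>s\<close> on the whole half-line, so it can later be
  averaged knowing only the mean of \<open>s\<close>.\<close>

lemma measure_lotto_scale_ge:
  assumes "1 \<le> c" and "0 \<le> s"
  shows "(1 - s / (2 * c)) / c \<le> measure uniform_01 {u \<in> space uniform_01. s \<le> lotto_scale c u}"
proof (cases "s \<le> 2 * c")
  case True
  interpret prob_space uniform_01
    by (rule prob_space_uniform_01)
  let ?I = "{s / (2 * c\<^sup>2)..1 / c}"
  have le: "s / (2 * c\<^sup>2) \<le> 1 / c" and nn: "0 \<le> s / (2 * c\<^sup>2)" and c1: "1 / c \<le> 1"
    using assms True by (auto simp: field_simps power2_eq_square)
  have sub: "?I \<subseteq> {u \<in> space uniform_01. s \<le> lotto_scale c u}"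
  proof
    fix u assume u: "u \<in> ?I"
    with assms have "s \<le> 2 * c\<^sup>2 * u"
      by (simp add: field_simps)
    with u nn c1 show "u \<in> {u \<in> space uniform_01. s \<le> lotto_scale c u}"
      by (auto simp: space_restrict_space lotto_scale_def)
  qed
  have "(1 - s / (2 * c)) / c = 1 / c - s / (2 * c\<^sup>2)"
    using assms by (simp add: field_simps power2_eq_square)
  also have "\<dots> = measure uniform_01 ?I"
    using le nn c1 by (subst measure_restrict_space) auto
  also have "\<dots> \<le> measure uniform_01 {u \<in> space uniform_01. s \<le> lotto_scale c u}"
  proof (rule finite_measure_mono[OF sub])
    have "lotto_scale c \<in> borel_measurable uniform_01"
      by (intro measurable_restrict_space1) simp
    then show "{u \<in> space uniform_01. s \<le> lotto_scale c u} \<in> sets uniform_01"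
      by measurable
  qed
  finally show ?thesis .
next
  case False
  then have "(1 - s / (2 * c)) / c \<le> 0"
    using assms by (simp add: field_simps)
  then show ?thesis
    using measure_nonneg order_trans by blast
qed

section \<open>The defender's randomly scaled allocation\<close>

definition scaled_allocation :: "real ^ 'm \<Rightarrow> real ^ 'n ^ 'm \<Rightarrow> real \<Rightarrow> real ^ 'm ^ 'n" where
  "scaled_allocation X S t = (\<chi> i j. t * X $ j * S $ j $ i)"

text \<open>One random factor is shared by all entries of the allocation, so that a large factor
  protects against all attack types at once. The target is the restricted space because membership
  in \<open>defender_strategies\<close> fixes that sigma-algebra.\<close>

definition lotto_strategy ::
    "real ^ 'm \<Rightarrow> real ^ 'n ^ 'm \<Rightarrow> real \<Rightarrow> (real ^ 'm ^ 'n) measure" where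
  "lotto_strategy X S c =
     distr uniform_01 (restrict_space borel defender_allocations)
       (\<lambda>u. scaled_allocation X S (lotto_scale c u))"

lemma sum_scaled_allocation_resource:
  assumes "S \<in> routing_matrices"
  shows "(\<Sum>i\<in>UNIV. scaled_allocation X S t $ i $ j) = t * X $ j"
  using assms by (simp add: scaled_allocation_def routing_matrices_def flip: sum_distrib_left)

lemma sum_scaled_allocation_attack:
  "(\<Sum>j\<in>UNIV. W $ j $ i * scaled_allocation X S t $ i $ j) = t * routed W X S i"
  by (simp add: scaled_allocation_def routed_def sum_distrib_left algebra_simps)

lemma measurable_lotto_allocation:
  fixes X :: "real ^ 'm" and S :: "real ^ 'n ^ 'm"
  assumes "\<forall>j. X $ j > 0" and "S \<in> routing_matrices"
  shows "(\<lambda>u. scaled_allocation X S (lotto_scale c u))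
    \<in> uniform_01 \<rightarrow>\<^sub>M restrict_space borel defender_allocations"
proof (rule measurable_restrict_space2)
  show "(\<lambda>u. scaled_allocation X S (lotto_scale c u)) \<in> space uniform_01 \<rightarrow> defender_allocations"
    using assms lotto_scale_nonneg
    by (auto simp: scaled_allocation_def defender_allocations_def routing_matrices_def less_imp_le)
  have "continuous_on UNIV (scaled_allocation X S)"
    unfolding scaled_allocation_def by (intro continuous_intros)
  then have "scaled_allocation X S \<in> borel_measurable borel"
    by (rule borel_measurable_continuous_onI)
  then have "(\<lambda>u. scaled_allocation X S (lotto_scale c u)) \<in> borel_measurable borel"
    by (rule measurable_compose[OF borel_measurable_lotto_scale])
  then show "(\<lambda>u. scaled_allocation X S (lotto_scale c u)) \<in> borel_measurable uniform_01"
    by (intro measurable_restrict_space1) simp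
qed

text \<open>The rows of \<open>S\<close> sum to 1, so resource \<open>j\<close> is used in total
  amount \<open>lotto_scale c u * X $ j\<close>; the factor has mean 1, which gives the required
  budget.\<close>

lemma lotto_strategy_in_defender_strategies:
  fixes X :: "real ^ 'm" and S :: "real ^ 'n ^ 'm"
  assumes "\<forall>j. X $ j > 0" and "S \<in> routing_matrices" and "1 \<le> c"
  shows "lotto_strategy X S c \<in> defender_strategies X"
proof -
  note meas = measurable_lotto_allocation[OF assms(1,2)]
  have "has_bochner_integral (lotto_strategy X S c) (\<lambda>x. \<Sum>i\<in>UNIV. x $ i $ j) (X $ j)" for j
    unfolding lotto_strategy_def
  proof (rule has_bochner_integral_distr[OF _ meas])
    show "(\<lambda>x :: real ^ 'm ^ 'n. \<Sum>i\<in>UNIV. x $ i $ j)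
        \<in> borel_measurable (restrict_space borel defender_allocations)"
      by (intro measurable_restrict_space1 borel_measurable_continuous_onI continuous_intros)
    show "has_bochner_integral uniform_01
        (\<lambda>u. \<Sum>i\<in>UNIV. scaled_allocation X S (lotto_scale c u) $ i $ j) (X $ j)"
      using has_bochner_integral_mult_left[OF has_bochner_integral_lotto_scale[OF assms(3)],
          of "X $ j"]
      by (simp add: sum_scaled_allocation_resource[OF assms(2)])
  qed
  moreover have "prob_space (lotto_strategy X S c)"
    unfolding lotto_strategy_def by (rule prob_space.prob_space_distr[OF prob_space_uniform_01 meas])
  ultimately show ?thesis
    by (simp add: defender_strategies_def lotto_strategy_def)
qed

section \<open>Payoff against an arbitrary attacker\<close>

text \<open>Joint measurability serves Fubini's theorem and, through sections, the case of a fixed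
  attack.\<close>

lemma measurable_defense_event:
  fixes W :: "real ^ 'n ^ 'm"
  shows "(\<lambda>(x, y). of_bool (\<forall>i. y $ i \<le> (\<Sum>j\<in>UNIV. W $ j $ i * x $ i $ j)) :: real)
    \<in> borel_measurable (restrict_space borel defender_allocations
        \<Otimes>\<^sub>M restrict_space borel attacker_allocations)"
proof -
  have [measurable]: "(\<lambda>x. x $ i $ j)
      \<in> borel_measurable (restrict_space borel (defender_allocations :: (real ^ 'm ^ 'n) set))" for i j
    by (intro measurable_restrict_space1 borel_measurable_continuous_onI continuous_intros)
  have [measurable]: "(\<lambda>y. y $ i)
      \<in> borel_measurable (restrict_space borel (attacker_allocations :: (real ^ 'n) set))" for i
    by (intro measurable_restrict_space1 borel_measurable_continuous_onI continuous_intros)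
  show ?thesis
    by measurable
qed

lemma prob_lotto_strategy_wins:
  fixes W :: "real ^ 'n ^ 'm"
  assumes X: "\<forall>j. X $ j > 0" and S: "S \<in> routing_matrices" and c: "1 \<le> c"
    and z: "\<forall>i. routed W X S i > 0" and y: "y \<in> attacker_allocations"
  shows "(1 - (\<Sum>i\<in>UNIV. y $ i / routed W X S i) / (2 * c)) / c
    \<le> (\<integral>x. of_bool (\<forall>i. y $ i \<le> (\<Sum>j\<in>UNIV. W $ j $ i * x $ i $ j)) \<partial>lotto_strategy X S c)"
proof -
  interpret U: prob_space uniform_01
    by (rule prob_space_uniform_01)
  define s where "s = (\<Sum>i\<in>UNIV. y $ i / routed W X S i)"
  have y0: "0 \<le> y $ i" for i
    using y by (simp add: attacker_allocations_def)
  have term_nonneg: "0 \<le> y $ i / routed W X S i" for i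
    using y0 z by (simp add: less_imp_le)
  \<comment> \<open>The exact threshold for winning is the largest ratio
    \<open>y $ i / routed W X S i\<close>. It is replaced by the sum \<open>s\<close> of these
    nonnegative ratios because the mean of the sum is determined by the attacker's budgets, while
    that of the maximum is not.\<close>
  have wins: "y $ i \<le> t * routed W X S i" if "s \<le> t" for i t
  proof -
    have "y $ i / routed W X S i \<le> s"
      unfolding s_def using term_nonneg by (intro member_le_sum) auto
    with that z show ?thesis
      by (simp add: pos_divide_le_eq[symmetric])
  qed
  let ?win = "\<lambda>x. of_bool (\<forall>i. y $ i \<le> (\<Sum>j\<in>UNIV. W $ j $ i * x $ i $ j)) :: real"
  \<comment> \<open>This is the section of the defense event at the fixed attack
    \<open>y\<close>.\<close>
  have [measurable]: "?win \<in> borel_measurable (restrict_space borel defender_allocations)"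
    using measurable_compose[OF measurable_Pair2' measurable_defense_event, of y] y
    by (simp add: space_restrict_space)
  have [measurable]: "lotto_scale c \<in> borel_measurable uniform_01"
    by (intro measurable_restrict_space1) simp
  note [measurable] = measurable_lotto_allocation[OF X S]
  have "(1 - s / (2 * c)) / c \<le> measure uniform_01 {u \<in> space uniform_01. s \<le> lotto_scale c u}"
    unfolding s_def using term_nonneg by (intro measure_lotto_scale_ge c sum_nonneg)
  also have "\<dots> = (\<integral>u. indicator {u \<in> space uniform_01. s \<le> lotto_scale c u} u \<partial>uniform_01)"
    by (simp only: Bochner_Integration.integral_indicator Int_absorb2 Collect_restrict)
  also have "\<dots> \<le> (\<integral>u. ?win (scaled_allocation X S (lotto_scale c u)) \<partial>uniform_01)"
  proof (rule integral_mono)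
    show "integrable uniform_01 (indicator {u \<in> space uniform_01. s \<le> lotto_scale c u} :: real \<Rightarrow> real)"
      by (intro integrable_real_indicator) (measurable, simp add: U.emeasure_eq_measure)
    show "integrable uniform_01 (\<lambda>u. ?win (scaled_allocation X S (lotto_scale c u)))"
      by (intro U.integrable_const_bound[where B = 1]) auto
  qed (auto simp: indicator_def sum_scaled_allocation_attack wins)
  also have "\<dots> = (\<integral>x. ?win x \<partial>lotto_strategy X S c)"
    unfolding lotto_strategy_def by (subst integral_distr) auto
  finally show ?thesis
    by (simp add: s_def)
qed

text \<open>The bound for a fixed attack is affine in \<open>y\<close>, so its expectation depends
  on \<open>FY\<close> only through the means \<open>Y $ i\<close>. Independence allows conditioning
  on \<open>y\<close> first.\<close>

lemma lotto_strategy_payoff_ge: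
  fixes W :: "real ^ 'n ^ 'm"
  assumes X: "\<forall>j. X $ j > 0" and S: "S \<in> routing_matrices" and c: "1 \<le> c"
    and z: "\<forall>i. routed W X S i > 0" and FY: "FY \<in> attacker_strategies Y"
  shows "(1 - (\<Sum>i\<in>UNIV. Y $ i / routed W X S i) / (2 * c)) / c
    \<le> defender_payoff W (lotto_strategy X S c) FY"
proof -
  let ?FX = "lotto_strategy X S c"
  have FX: "?FX \<in> defender_strategies X"
    by (rule lotto_strategy_in_defender_strategies[OF X S c])
  interpret FX: prob_space ?FX
    using FX by (simp add: defender_strategies_def)
  interpret FY: prob_space FY
    using FY by (simp add: attacker_strategies_def)
  interpret P: pair_prob_space ?FX FY ..
  have sets_FX: "sets ?FX = sets (restrict_space borel defender_allocations)"
    using FX by (simp add: defender_strategies_def)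
  have sets_FY: "sets FY = sets (restrict_space borel attacker_allocations)"
    using FY by (simp add: attacker_strategies_def)
  have space_FY: "space FY = attacker_allocations"
    using sets_eq_imp_space_eq[OF sets_FY] by (simp add: space_restrict_space)
  let ?win = "\<lambda>x y. of_bool (\<forall>i. y $ i \<le> (\<Sum>j\<in>UNIV. W $ j $ i * x $ i $ j)) :: real"
  let ?g = "\<lambda>y. (1 - (\<Sum>i\<in>UNIV. y $ i / routed W X S i) / (2 * c)) / c"
  have "(\<lambda>(x, y). ?win x y) \<in> borel_measurable (?FX \<Otimes>\<^sub>M FY)"
    using measurable_defense_event
    by (subst measurable_cong_sets[OF sets_pair_measure_cong[OF sets_FX sets_FY] refl])
  then have win: "integrable (?FX \<Otimes>\<^sub>M FY) (\<lambda>(x, y). ?win x y)"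
    by (intro P.integrable_const_bound[where B = 1]) auto
  have "has_bochner_integral FY (\<lambda>y. y $ i) (Y $ i)" for i
    using FY by (simp add: attacker_strategies_def)
  moreover have "has_bochner_integral FY (\<lambda>_. 1) (1 :: real)"
    by (simp add: has_bochner_integral_iff FY.prob_space)
  \<comment> \<open>By linearity the expectation of \<open>?g\<close> is \<open>?g\<close> at the
    mean; the constant term uses that \<open>FY\<close> has mass 1.\<close>
  ultimately have g: "has_bochner_integral FY ?g (?g Y)"
    by (intro has_bochner_integral_divide_zero has_bochner_integral_diff has_bochner_integral_sum)
  have "?g Y = (\<integral>y. ?g y \<partial>FY)"
    by (rule has_bochner_integral_integral_eq[OF g, symmetric])
  also have "\<dots> \<le> (\<integral>y. (\<integral>x. ?win x y \<partial>?FX) \<partial>FY)"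
  proof (rule integral_mono)
    show "integrable FY ?g"
      using g by (simp add: has_bochner_integral_iff)
    show "integrable FY (\<lambda>y. \<integral>x. ?win x y \<partial>?FX)"
      using P.integrable_snd[OF win] .
  qed (use prob_lotto_strategy_wins[OF X S c z] space_FY in simp)
  \<comment> \<open>Fubini: the payoff is the average over \<open>y\<close> of the winning
    probabilities for fixed \<open>y\<close>.\<close>
  also have "\<dots> = defender_payoff W ?FX FY"
    unfolding defender_payoff_def by (rule P.integral_snd[OF win])
  finally show ?thesis .
qed

section \<open>Passage to the max-min value\<close>

lemma max_min_value_ge:
  fixes W :: "real ^ 'n ^ 'm"
  assumes "\<forall>i. Y $ i > 0" and FX: "FX \<in> defender_strategies X"
    and ge: "\<And>FY. FY \<in> attacker_strategies Y \<Longrightarrow> v \<le> defender_payoff W FX FY"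
  shows "v \<le> max_min_value W X Y"
proof -
  let ?inf = "\<lambda>FX. INF FY \<in> attacker_strategies Y. defender_payoff W FX FY"
  obtain FY where FY: "FY \<in> attacker_strategies Y"
    using attacker_strategies_nonempty[OF assms(1)] by blast
  \<comment> \<open>A real supremum dominates its members only if the family is bounded above. Any
    single attacker strategy bounds each inner infimum by 1.\<close>
  have "?inf FX \<le> 1" if "FX \<in> defender_strategies X" for FX
    using defender_payoff_bounds[OF that]
    by (intro cINF_lower2[OF _ FY] bdd_belowI2[where m = 0]) (use FY in blast)+
  then have "bdd_above (?inf ` defender_strategies X)"
    by (intro bdd_aboveI2[where M = 1])
  moreover have "v \<le> ?inf FX"
    using FY ge by (intro cINF_greatest) auto
  ultimately show ?thesis
    unfolding max_min_value_def using FX by (intro cSUP_upper2)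
qed

text \<open>With \<open>c = max 1 a\<close> the two branches become one formula:
  \<open>c = 1\<close> gives \<open>1 - a / 2\<close>, and \<open>c = a\<close> gives
  \<open>(1 - 1 / 2) / a\<close>.\<close>

lemma lower_bound_ennreal:
  assumes "0 \<le> a"
  shows "lower_bound (ennreal a) = (1 - a / (2 * max 1 a)) / max 1 a"
proof (cases "a \<le> 1")
  case True
  then have "ennreal a \<le> 1"
    using assms by simp
  then show ?thesis
    using True assms by (simp add: lower_bound_def max_def)
next
  case False
  then have "1 / (2 * ennreal a) = ennreal (1 / (2 * a))"
    using divide_ennreal[of 1 "2 * a"] by (simp add: ennreal_mult)
  then show ?thesis
    using False by (simp add: lower_bound_def max_def field_simps)
qed

lemma alpha_eq_ennreal:
  assumes "\<forall>i. routed W X S i > 0" and "\<forall>i. Y $ i > 0"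
  shows "alpha W X Y S = ennreal (\<Sum>i\<in>UNIV. Y $ i / routed W X S i)"
  using assms by (simp add: alpha_def divide_ennreal sum_ennreal less_imp_le)

theorem theorem3:
  fixes W :: "real ^ 'n ^ 'm" and X :: "real ^ 'm" and Y :: "real ^ 'n"
  assumes "\<forall>j i. W $ j $ i \<ge> 0"
    and "\<forall>j. X $ j > 0"
    and "\<forall>i. Y $ i > 0"
  shows "max_min_value W X Y \<ge> lower_bound (alpha_star W X Y)"
proof -
  obtain S where S: "S \<in> routing_matrices" and opt: "alpha W X Y S = alpha_star W X Y"
    using alpha_star_attained[OF assms(3)] by blast
  show ?thesis
  proof (cases "\<exists>i. routed W X S i = 0")
    case True
    \<comment> \<open>If even an optimal routing leaves an attack type uncovered, the claimed bound
      is 0, and any defender strategy attains it since payoffs are nonnegative.\<close>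
    have "alpha_star W X Y = \<infinity>"
      using True alpha_eq_infinity[OF assms(3)] opt by metis
    moreover obtain FX :: "(real ^ 'm ^ 'n) measure" where FX: "FX \<in> defender_strategies X"
      using defender_strategies_nonempty[OF assms(2)] by blast
    ultimately show ?thesis
      using max_min_value_ge[OF assms(3) FX] defender_payoff_bounds(1)[OF FX]
      by (simp only: lower_bound_infinity)
  next
    case False
    \<comment> \<open>Nonnegativity of \<open>W\<close> enters here: a nonzero
      \<open>routed W X S i\<close> is then positive, so all ratios are finite.\<close>
    have "0 \<le> routed W X S i" for i
      using S assms by (auto simp: routed_def routing_matrices_def less_imp_le intro!: sum_nonneg)
    with False have z: "\<forall>i. routed W X S i > 0"
      by (metis order_le_less)
    define a where "a = (\<Sum>i\<in>UNIV. Y $ i / routed W X S i)"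
    have a: "0 \<le> a"
      unfolding a_def using z assms(3) by (intro sum_nonneg) (simp add: less_imp_le)
    \<comment> \<open>The parameter \<open>max 1 a\<close> keeps the support probability
      \<open>1 / c\<close> at most 1 and makes the payoff bound coincide with
      \<open>lower_bound\<close>.\<close>
    have c: "1 \<le> max 1 a"
      by simp
    have "(1 - a / (2 * max 1 a)) / max 1 a \<le> max_min_value W X Y"
      using lotto_strategy_payoff_ge[OF assms(2) S c z]
      by (intro max_min_value_ge[OF assms(3)
            lotto_strategy_in_defender_strategies[OF assms(2) S c]]) (simp add: a_def)
    moreover have "alpha_star W X Y = ennreal a"
      using alpha_eq_ennreal[OF z assms(3)] opt by (simp add: a_def)
    ultimately show ?thesis
      using lower_bound_ennreal[OF a] by simp
  qed
qed

end
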